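(* Let $(\boldsymbol g_t)_{t\ge1}\subset\mathbb R^d$ be any sequence with $\|\boldsymbol g_1\|>0$, and let $(h_t)_{t\ge1}$ be hints such that $(h_t)$ is non-decreasing, $h_t\ge \max_{s\le t}\|\boldsymbol g_s\|$ for all $t\ge 1$, and the hints are multiplied by $c$ whenever the sequence $(\boldsymbol g_s)$ is multiplied by a factor $c>0$. Let $(\widehat{\boldsymbol w}_t)$ be the outputs of the algorithm FreeRange (defined in the context). Then for all $\boldsymbol w\in\mathbb R^d$ and $T\ge 1$, $$\sum_{t=1}^T\langle\boldsymbol g_t,\widehat{\boldsymbol w}_t-\boldsymbol w\rangle\le 2\|\boldsymbol w\|\sqrt{2V_T\ln_+(\|\boldsymbol w\|b_T)}+h_T\cdot\bigl(16\|\boldsymbol w\|\ln_+(2\|\boldsymbol w\|b_T)+2\|\boldsymbol w\|+3\bigr),$$ where $V_T:=h_1^2+\sum_{t=1}^T\|\boldsymbol g_t\|^2$ and $$b_T:=2\sum_{t=1}^T\left(\sum_{s=1}^{t-1}\frac{\|\boldsymbol g_s\|}{h_s}+2\right)^2\le (T+1)^3 .$$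
   Context: $\|\cdot\|$ is the Euclidean norm, $\ln_+(\cdot):=\max\{0,\ln(\cdot)\}$ with $\ln_+0=0$. In each round $t\ge1$ the learner sees a hint $h_t$, outputs $\widehat{\boldsymbol w}_t\in\mathbb R^d$, and then $\boldsymbol g_t\in\mathbb R^d$ is revealed. FreeRange: initialize $\tau=1$. For $t=1,2,\dots$: observe $h_t$; if $h_t/h_\tau>\sum_{s=1}^{t-1}\|\boldsymbol g_s\|/h_s+2$, set $\tau=t$ (restart). Then, with $V:=h_\tau^2+\sum_{s=\tau}^{t-1}\|\boldsymbol g_s\|^2$ and $\mathbf G:=\sum_{s=\tau}^{t-1}\boldsymbol g_s$, output $$\widehat{\boldsymbol w}_t:=-\mathbf G\cdot\frac{(2V+h_t\|\mathbf G\|)\,h_\tau^2}{2(V+h_t\|\mathbf G\|)^2\sqrt{V}}\cdot\exp\left(\frac{\|\mathbf G\|^2}{2V+2h_t\|\mathbf G\|}\right).$$ *)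

theory Defs
  imports "HOL-Analysis.Analysis"
begin

definition ln_plus :: "real \<Rightarrow> real" where
  "ln_plus x = (if x = 0 then 0 else max 0 (ln x))"

text \<open>Sequences are indexed by rounds \<open>1, 2, \<dots>\<close>; values at index \<open>0\<close> are never used.
  In \<open>restart_round g h t\<close>, with \<open>g\<close> the revealed vectors and \<open>h\<close> the hints, the result is the
  value of the variable \<open>\<tau>\<close> after the restart test of round \<open>t\<close>, with \<open>t = 0\<close> standing for the
  initialization.\<close>

fun restart_round :: "(nat \<Rightarrow> 'a::real_normed_vector) \<Rightarrow> (nat \<Rightarrow> real) \<Rightarrow> nat \<Rightarrow> nat" where
  "restart_round g h 0 = 1"
| "restart_round g h (Suc n) =
    (if h (Suc n) / h (restart_round g h n) > (\<Sum>s = 1..n. norm (g s) / h s) + 2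
     then Suc n else restart_round g h n)"

definition free_range :: "(nat \<Rightarrow> 'a::real_normed_vector) \<Rightarrow> (nat \<Rightarrow> real) \<Rightarrow> nat \<Rightarrow> 'a" where
  "free_range g h t =
    (let \<tau> = restart_round g h t;
         V = (h \<tau>)\<^sup>2 + (\<Sum>s = \<tau>..<t. (norm (g s))\<^sup>2);
         G = (\<Sum>s = \<tau>..<t. g s)
     in ((2 * V + h t * norm G) * (h \<tau>)\<^sup>2 / (2 * (V + h t * norm G)\<^sup>2 * sqrt V)
         * exp ((norm G)\<^sup>2 / (2 * V + 2 * h t * norm G))) *\<^sub>R (- G))"

definition V_total :: "(nat \<Rightarrow> 'a::real_normed_vector) \<Rightarrow> (nat \<Rightarrow> real) \<Rightarrow> nat \<Rightarrow> real" where
  "V_total g h T = (h 1)\<^sup>2 + (\<Sum>t = 1..T. (norm (g t))\<^sup>2)"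

definition b_total :: "(nat \<Rightarrow> 'a::real_normed_vector) \<Rightarrow> (nat \<Rightarrow> real) \<Rightarrow> nat \<Rightarrow> real" where
  "b_total g h T = 2 * (\<Sum>t = 1..T. ((\<Sum>s = 1..<t. norm (g s) / h s) + 2)\<^sup>2)"

end

theory Submission
  imports Defs
begin

text \<open>FreeRange plays the negative gradient of the potential
  \<open>\<Phi>(V, h, G) = exp (\<parallel>G\<parallel>\<^sup>2 / (2 V + 2 h \<parallel>G\<parallel>)) / sqrt V\<close>, scaled by \<open>h\<^sub>\<tau>\<^sup>2\<close>. The key inequality is
  \<open>\<Phi>(V + \<parallel>v\<parallel>\<^sup>2, h, G + v) \<le> \<Phi>(V, h, G) + \<langle>v, \<nabla>\<Phi>(V, h, G)\<rangle>\<close> for \<open>\<parallel>v\<parallel> \<le> h\<close>: it telescopes, so that the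
  loss since a restart is at most \<open>h\<^sub>\<tau> - h\<^sub>\<tau>\<^sup>2 \<Phi>\<close>, and the regret against \<open>w\<close> is then at most \<open>h\<^sub>\<tau>\<close> plus
  the convex conjugate of \<open>h\<^sub>\<tau>\<^sup>2 \<Phi>\<close> at \<open>\<parallel>w\<parallel>\<close>.

  The component of \<open>v\<close> orthogonal to \<open>G\<close> only decreases \<open>\<Phi>\<close>. In the collinear case, scale \<open>v\<close> and \<open>h\<close>
  together by \<open>s\<close> from \<open>0\<close> to \<open>1\<close>: the logarithmic gap between both sides is nondecreasing in \<open>s\<close>,
  because its derivative is a fraction whose numerator has only nonnegative coefficients in suitable
  variables. (With \<open>h\<close> kept fixed the gap is not monotone.)

  A restart at least doubles the hint, so the losses of all epochs sum to at most \<open>2 h\<^sub>\<tau>\<close>. Only the last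
  two epochs are compared with \<open>w\<close> by the conjugate bound. Before those, the restart condition gives
  \<open>\<Sum>\<parallel>g\<^sub>t\<parallel> \<le> h\<^sub>\<tau>\<close> at the last restart \<open>\<tau>\<close>.\<close>

subsection \<open>The one-step inequality in one dimension\<close>

text \<open>\<open>step_num\<close> is the numerator of the derivative of the logarithmic gap, for a step \<open>c\<close> from \<open>z\<close> to a
  point of modulus \<open>N\<close>. In the following three lemmas \<open>f\<close> is the slack \<open>h - \<bar>c\<bar>\<close>; together with
  \<open>a\<close> and \<open>b\<close> it makes every coefficient of the expanded polynomial nonnegative.\<close>

definition step_num :: "real \<Rightarrow> real \<Rightarrow> real \<Rightarrow> real \<Rightarrow> real \<Rightarrow> real" where
  "step_num V z N c h =
    (let W = V + c^2; A = V + h*z; B = W + h*N; p = c*z; X = 2*A^2 + p*(2*V + h*z)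
     in 4*p*V^2*A*W*B^2 + 2*c^2*A^2*X*B^2
        + (2*c^2*N^2 - (p + c^2)*(2*W + h*N) + h*N^3)*A^2*X*W - h*z^3*X*W*B^2)"

lemma step_num_pos:
  assumes "V \<ge> 0" "a \<ge> 0" "b \<ge> 0" "f \<ge> 0"
  shows "step_num V a (a+b) b (b+f) \<ge> 0"
proof -
  have "step_num V a (a+b) b (b+f) =
    4*a^4*b^4*f^6 + 34*a^4*b^5*f^5 + 118*a^4*b^6*f^4 + 214*a^4*b^7*f^3 + 214*a^4*b^8*f^2 +
    112*a^4*b^9*f + 24*a^4*b^10 + 8*a^5*b^3*f^6 + 60*a^5*b^4*f^5 + 184*a^5*b^5*f^4 +
    294*a^5*b^6*f^3 + 257*a^5*b^7*f^2 + 116*a^5*b^8*f + 21*a^5*b^9 + 4*a^6*b^2*f^6 +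
    26*a^6*b^3*f^5 + 70*a^6*b^4*f^4 + 100*a^6*b^5*f^3 + 80*a^6*b^6*f^2 + 34*a^6*b^7*f + 6*a^6*b^8
    + 16*V*a^3*b^4*f^5 + 120*V*a^3*b^5*f^4 + 352*V*a^3*b^6*f^3 + 504*V*a^3*b^7*f^2 +
    352*V*a^3*b^8*f + 96*V*a^3*b^9 + 40*V*a^4*b^3*f^5 + 260*V*a^4*b^4*f^4 + 668*V*a^4*b^5*f^3 +
    844*V*a^4*b^6*f^2 + 522*V*a^4*b^7*f + 126*V*a^4*b^8 + 24*V*a^5*b^2*f^5 + 132*V*a^5*b^3*f^4 +
    290*V*a^5*b^4*f^3 + 319*V*a^5*b^5*f^2 + 176*V*a^5*b^6*f + 39*V*a^5*b^7 + 24*V^2*a^2*b^4*f^4 +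
    158*V^2*a^2*b^5*f^3 + 382*V^2*a^2*b^6*f^2 + 400*V^2*a^2*b^7*f + 152*V^2*a^2*b^8 +
    80*V^2*a^3*b^3*f^4 + 438*V^2*a^3*b^4*f^3 + 895*V^2*a^3*b^5*f^2 + 804*V^2*a^3*b^6*f +
    267*V^2*a^3*b^7 + 60*V^2*a^4*b^2*f^4 + 276*V^2*a^4*b^3*f^3 + 478*V^2*a^4*b^4*f^2 +
    372*V^2*a^4*b^5*f + 110*V^2*a^4*b^6 + 4*V^2*a^5*b^2*f^3 + 14*V^2*a^5*b^3*f^2 +
    16*V^2*a^5*b^4*f + 6*V^2*a^5*b^5 + 16*V^3*a*b^4*f^3 + 88*V^3*a*b^5*f^2 + 160*V^3*a*b^6*f +
    96*V^3*a*b^7 + 84*V^3*a^2*b^3*f^3 + 368*V^3*a^2*b^4*f^2 + 540*V^3*a^2*b^5*f + 260*V^3*a^2*b^6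
    + 82*V^3*a^3*b^2*f^3 + 303*V^3*a^3*b^3*f^2 + 374*V^3*a^3*b^4*f + 157*V^3*a^3*b^5 +
    10*V^3*a^4*b^2*f^2 + 26*V^3*a^4*b^3*f + 16*V^3*a^4*b^4 + 4*V^4*b^4*f^2 + 16*V^4*b^5*f +
    16*V^4*b^6 + 44*V^4*a*b^3*f^2 + 138*V^4*a*b^4*f + 114*V^4*a*b^5 + 60*V^4*a^2*b^2*f^2 +
    162*V^4*a^2*b^3*f + 106*V^4*a^2*b^4 + 6*V^4*a^3*b^2*f + 10*V^4*a^3*b^3 + 8*V^5*b^3*f +
    12*V^5*b^4 + 18*V^5*a*b^2*f + 30*V^5*a*b^3"
    unfolding step_num_def Let_def by algebra
  also have "\<dots> \<ge> 0"
    using assms by (intro add_nonneg_nonneg mult_nonneg_nonneg zero_le_power) simp_all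
  finally show ?thesis .
qed

lemma step_num_neg:
  assumes "V \<ge> 0" "a \<ge> 0" "b \<ge> 0" "f \<ge> 0"
  shows "step_num V (a+b) a (-b) (b+f) \<ge> 0"
proof -
  have "step_num V (a+b) a (-b) (b+f) =
    4*b^10*f^4 + 12*b^11*f^3 + 13*b^12*f^2 + 6*b^13*f + b^14 + 8*a*b^8*f^5 + 52*a*b^9*f^4 +
    110*a*b^10*f^3 + 103*a*b^11*f^2 + 44*a*b^12*f + 7*a*b^13 + 4*a^2*b^6*f^6 + 54*a^2*b^7*f^5 +
    218*a^2*b^8*f^4 + 380*a^2*b^9*f^3 + 322*a^2*b^10*f^2 + 130*a^2*b^11*f + 20*a^2*b^12 +
    16*a^3*b^5*f^6 + 136*a^3*b^6*f^5 + 432*a^3*b^7*f^4 + 660*a^3*b^8*f^3 + 518*a^3*b^9*f^2 +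
    200*a^3*b^10*f + 30*a^3*b^11 + 24*a^4*b^4*f^6 + 164*a^4*b^5*f^5 + 448*a^4*b^6*f^4 +
    620*a^4*b^7*f^3 + 457*a^4*b^8*f^2 + 170*a^4*b^9*f + 25*a^4*b^10 + 16*a^5*b^3*f^6 +
    96*a^5*b^4*f^5 + 236*a^5*b^5*f^4 + 302*a^5*b^6*f^3 + 211*a^5*b^7*f^2 + 76*a^5*b^8*f +
    11*a^5*b^9 + 4*a^6*b^2*f^6 + 22*a^6*b^3*f^5 + 50*a^6*b^4*f^4 + 60*a^6*b^5*f^3 + 40*a^6*b^6*f^2
    + 14*a^6*b^7*f + 2*a^6*b^8 + 8*V*b^8*f^4 + 38*V*b^9*f^3 + 57*V*b^10*f^2 + 34*V*b^11*f +
    7*V*b^12 + 8*V*a*b^6*f^5 + 100*V*a*b^7*f^4 + 314*V*a*b^8*f^3 + 393*V*a*b^9*f^2 +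
    212*V*a*b^10*f + 41*V*a*b^11 + 48*V*a^2*b^5*f^5 + 360*V*a^2*b^6*f^4 + 908*V*a^2*b^7*f^3 +
    1010*V*a^2*b^8*f^2 + 508*V*a^2*b^9*f + 94*V*a^2*b^10 + 96*V*a^3*b^4*f^5 + 560*V*a^3*b^5*f^4 +
    1220*V*a^3*b^6*f^3 + 1242*V*a^3*b^7*f^2 + 592*V*a^3*b^8*f + 106*V*a^3*b^9 + 80*V*a^4*b^3*f^5 +
    400*V*a^4*b^4*f^4 + 782*V*a^4*b^5*f^3 + 741*V*a^4*b^6*f^2 + 338*V*a^4*b^7*f + 59*V*a^4*b^8 +
    24*V*a^5*b^2*f^5 + 108*V*a^5*b^3*f^4 + 194*V*a^5*b^4*f^3 + 173*V*a^5*b^5*f^2 + 76*V*a^5*b^6*f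
    + 13*V*a^5*b^7 + 4*V^2*b^6*f^4 + 40*V^2*b^7*f^3 + 95*V^2*b^8*f^2 + 76*V^2*b^9*f + 17*V^2*b^10
    + 48*V^2*a*b^5*f^4 + 298*V^2*a*b^6*f^3 + 557*V^2*a*b^7*f^2 + 392*V^2*a*b^8*f + 85*V^2*a*b^9 +
    144*V^2*a^2*b^4*f^4 + 692*V^2*a^2*b^5*f^3 + 1121*V^2*a^2*b^6*f^2 + 728*V^2*a^2*b^7*f +
    155*V^2*a^2*b^8 + 160*V^2*a^3*b^3*f^4 + 654*V^2*a^3*b^4*f^3 + 961*V^2*a^3*b^5*f^2 +
    592*V^2*a^3*b^6*f + 125*V^2*a^3*b^7 + 60*V^2*a^4*b^2*f^4 + 224*V^2*a^4*b^3*f^3 +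
    312*V^2*a^4*b^4*f^2 + 188*V^2*a^4*b^5*f + 40*V^2*a^4*b^6 + 4*V^2*a^5*b^2*f^3 +
    10*V^2*a^5*b^3*f^2 + 8*V^2*a^5*b^4*f + 2*V^2*a^5*b^5 + 14*V^3*b^5*f^3 + 71*V^3*b^6*f^2 +
    84*V^3*b^7*f + 19*V^3*b^8 + 94*V^3*a*b^4*f^3 + 343*V^3*a*b^5*f^2 + 342*V^3*a*b^6*f +
    81*V^3*a*b^7 + 162*V^3*a^2*b^3*f^3 + 491*V^3*a^2*b^4*f^2 + 446*V^3*a^2*b^5*f + 109*V^3*a^2*b^6
    + 82*V^3*a^3*b^2*f^3 + 229*V^3*a^3*b^3*f^2 + 202*V^3*a^3*b^4*f + 51*V^3*a^3*b^5 +
    10*V^3*a^4*b^2*f^2 + 14*V^3*a^4*b^3*f + 4*V^3*a^4*b^4 + 20*V^4*b^4*f^2 + 46*V^4*b^5*f +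
    10*V^4*b^6 + 76*V^4*a*b^3*f^2 + 136*V^4*a*b^4*f + 36*V^4*a*b^5 + 60*V^4*a^2*b^2*f^2 +
    96*V^4*a^2*b^3*f + 28*V^4*a^2*b^4 + 6*V^4*a^3*b^2*f + 2*V^4*a^3*b^3 + 10*V^5*b^3*f + 2*V^5*b^4
    + 18*V^5*a*b^2*f + 6*V^5*a*b^3"
    unfolding step_num_def Let_def by algebra
  also have "\<dots> \<ge> 0"
    using assms by (intro add_nonneg_nonneg mult_nonneg_nonneg zero_le_power) simp_all
  finally show ?thesis .
qed

lemma step_num_cross:
  assumes "V \<ge> 0" "a \<ge> 0" "b \<ge> 0" "f \<ge> 0"
  shows "step_num V a b (-(a+b)) (a+b+f) \<ge> 0"
proof -
  have "step_num V a b (-(a+b)) (a+b+f) =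
    4*a^4*b^4*f^6 + 30*a^4*b^5*f^5 + 90*a^4*b^6*f^4 + 138*a^4*b^7*f^3 + 114*a^4*b^8*f^2 +
    48*a^4*b^9*f + 8*a^4*b^10 + 8*a^5*b^3*f^6 + 94*a^5*b^4*f^5 + 378*a^5*b^5*f^4 + 720*a^5*b^6*f^3
    + 707*a^5*b^7*f^2 + 344*a^5*b^8*f + 65*a^5*b^9 + 4*a^6*b^2*f^6 + 106*a^6*b^3*f^5 +
    634*a^6*b^4*f^4 + 1574*a^6*b^5*f^3 + 1889*a^6*b^6*f^2 + 1082*a^6*b^7*f + 235*a^6*b^8 +
    50*a^7*b^2*f^5 + 538*a^7*b^3*f^4 + 1868*a^7*b^4*f^3 + 2843*a^7*b^5*f^2 + 1962*a^7*b^6*f +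
    498*a^7*b^7 + 8*a^8*b*f^5 + 240*a^8*b^2*f^4 + 1302*a^8*b^3*f^3 + 2645*a^8*b^4*f^2 +
    2266*a^8*b^5*f + 686*a^8*b^6 + 52*a^9*b*f^4 + 536*a^9*b^2*f^3 + 1569*a^9*b^3*f^2 +
    1738*a^9*b^4*f + 644*a^9*b^5 + 4*a^10*f^4 + 122*a^10*b*f^3 + 587*a^10*b^2*f^2 + 894*a^10*b^3*f
    + 420*a^10*b^4 + 12*a^11*f^3 + 129*a^11*b*f^2 + 302*a^11*b^2*f + 190*a^11*b^3 + 13*a^12*f^2 +
    62*a^12*b*f + 58*a^12*b^2 + 6*a^13*f + 11*a^13*b + a^14 + 16*V*a^3*b^4*f^5 + 104*V*a^3*b^5*f^4
    + 256*V*a^3*b^6*f^3 + 296*V*a^3*b^7*f^2 + 160*V*a^3*b^8*f + 32*V*a^3*b^9 + 40*V*a^4*b^3*f^5 +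
    372*V*a^4*b^4*f^4 + 1180*V*a^4*b^5*f^3 + 1660*V*a^4*b^6*f^2 + 1054*V*a^4*b^7*f + 242*V*a^4*b^8
    + 28*V*a^5*b^2*f^5 + 482*V*a^5*b^3*f^4 + 2166*V*a^5*b^4*f^3 + 3889*V*a^5*b^5*f^2 +
    2986*V*a^5*b^6*f + 803*V*a^5*b^7 + 8*V*a^6*b*f^5 + 290*V*a^6*b^2*f^4 + 2048*V*a^6*b^3*f^3 +
    4961*V*a^6*b^4*f^2 + 4766*V*a^6*b^5*f + 1537*V*a^6*b^6 + 84*V*a^7*b*f^4 + 1076*V*a^7*b^2*f^3 +
    3766*V*a^7*b^3*f^2 + 4718*V*a^7*b^4*f + 1877*V*a^7*b^5 + 8*V*a^8*f^4 + 308*V*a^8*b*f^3 +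
    1738*V*a^8*b^2*f^2 + 3002*V*a^8*b^3*f + 1527*V*a^8*b^4 + 38*V*a^9*f^3 + 465*V*a^9*b*f^2 +
    1222*V*a^9*b^2*f + 837*V*a^9*b^3 + 57*V*a^10*f^2 + 298*V*a^10*b*f + 303*V*a^10*b^2 +
    34*V*a^11*f + 67*V*a^11*b + 7*V*a^12 + 24*V^2*a^2*b^4*f^4 + 130*V^2*a^2*b^5*f^3 +
    242*V^2*a^2*b^6*f^2 + 176*V^2*a^2*b^7*f + 40*V^2*a^2*b^8 + 80*V^2*a^3*b^3*f^4 +
    552*V^2*a^3*b^4*f^3 + 1251*V^2*a^3*b^5*f^2 + 1068*V^2*a^3*b^6*f + 275*V^2*a^3*b^7 +
    76*V^2*a^4*b^2*f^4 + 848*V^2*a^4*b^3*f^3 + 2579*V^2*a^4*b^4*f^2 + 2716*V^2*a^4*b^5*f +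
    815*V^2*a^4*b^6 + 32*V^2*a^5*b*f^4 + 628*V^2*a^5*b^2*f^3 + 2782*V^2*a^5*b^3*f^2 +
    3800*V^2*a^5*b^4*f + 1371*V^2*a^5*b^5 + 4*V^2*a^6*f^4 + 242*V^2*a^6*b*f^3 +
    1716*V^2*a^6*b^2*f^2 + 3220*V^2*a^6*b^3*f + 1451*V^2*a^6*b^4 + 40*V^2*a^7*f^3 +
    599*V^2*a^7*b*f^2 + 1696*V^2*a^7*b^2*f + 1009*V^2*a^7*b^3 + 95*V^2*a^8*f^2 + 528*V^2*a^8*b*f +
    461*V^2*a^8*b^2 + 76*V^2*a^9*f + 129*V^2*a^9*b + 17*V^2*a^10 + 16*V^3*a*b^4*f^3 +
    72*V^3*a*b^5*f^2 + 96*V^3*a*b^6*f + 32*V^3*a*b^7 + 76*V^3*a^2*b^3*f^3 + 360*V^3*a^2*b^4*f^2 +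
    520*V^3*a^2*b^5*f + 184*V^3*a^2*b^6 + 94*V^3*a^3*b^2*f^3 + 647*V^3*a^3*b^3*f^2 +
    1134*V^3*a^3*b^4*f + 437*V^3*a^3*b^5 + 56*V^3*a^4*b*f^3 + 595*V^3*a^4*b^2*f^2 +
    1346*V^3*a^4*b^3*f + 573*V^3*a^4*b^4 + 14*V^3*a^5*f^3 + 307*V^3*a^5*b*f^2 + 974*V^3*a^5*b^2*f
    + 476*V^3*a^5*b^3 + 71*V^3*a^6*f^2 + 422*V^3*a^6*b*f + 272*V^3*a^6*b^2 + 84*V^3*a^7*f +
    103*V^3*a^7*b + 19*V^3*a^8 + 4*V^4*b^4*f^2 + 16*V^4*b^5*f + 16*V^4*b^6 + 36*V^4*a*b^3*f^2 +
    102*V^4*a*b^4*f + 78*V^4*a*b^5 + 48*V^4*a^2*b^2*f^2 + 194*V^4*a^2*b^3*f + 136*V^4*a^2*b^4 +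
    44*V^4*a^3*b*f^2 + 204*V^4*a^3*b^2*f + 114*V^4*a^3*b^3 + 20*V^4*a^4*f^2 + 142*V^4*a^4*b*f +
    62*V^4*a^4*b^2 + 46*V^4*a^5*f + 32*V^4*a^5*b + 10*V^4*a^6 + 8*V^5*b^3*f + 12*V^5*b^4 +
    6*V^5*a*b^2*f + 18*V^5*a*b^3 + 12*V^5*a^2*b*f + 6*V^5*a^2*b^2 + 10*V^5*a^3*f + 2*V^5*a^3*b +
    2*V^5*a^4"
    unfolding step_num_def Let_def by algebra
  also have "\<dots> \<ge> 0"
    using assms by (intro add_nonneg_nonneg mult_nonneg_nonneg zero_le_power) simp_all
  finally show ?thesis .
qed

text \<open>The cases are a step away from the origin, a step towards it that does not pass it, and
  a step across it. In the second, the nonnegative parameters are the new point \<open>z + c\<close>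
  and the length \<open>-c\<close>; in the third, the moduli \<open>z\<close> and
  \<open>- (z + c)\<close> of both points.\<close>

lemma step_num_nonneg:
  assumes "V \<ge> 0" "z \<ge> 0" "\<bar>c\<bar> \<le> h"
  shows "step_num V z \<bar>z + c\<bar> c h \<ge> 0"
proof -
  consider "c \<ge> 0" | "c < 0" "z + c \<ge> 0" | "z + c < 0"
    by linarith
  then show ?thesis
  proof cases
    case 1
    with step_num_pos[of V z c "h - c"] assms show ?thesis by simp
  next
    case 2
    with step_num_neg[of V "z + c" "-c" "h + c"] assms show ?thesis by simp
  next
    case 3
    with step_num_cross[of V z "- (z + c)" "h + c"] assms show ?thesis by simp
  qed
qed

text \<open>The logarithm of the ratio of the two sides at scale \<open>s\<close>, up to the constant \<open>ln V / 2\<close>. For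
  \<open>e\<close> the sign of \<open>z + s*c\<close>, the product \<open>e*(z + s*c)\<close> is the modulus of the new point in a form that can
  be differentiated. The first logarithm is that of the linear factor, since
  \<open>z*(2*V + h*z) / (2*(V + h*z)^2) = (1 - (V / (V + h*z))^2) / (2*h)\<close>.\<close>

definition homotopy :: "real \<Rightarrow> real \<Rightarrow> real \<Rightarrow> real \<Rightarrow> real \<Rightarrow> real \<Rightarrow> real" where
  "homotopy V z c h e s =
     ln (1 + c / (2*h) * (1 - (V / (V + s*h*z))^2))
     - (z + s*c)^2 / (2 * (V + (s*c)^2 + s*h*(e*(z + s*c))))
     + ln (V + (s*c)^2) / 2 + z^2 / (2 * (V + s*h*z))"

text \<open>The bracket lies in [0, 1] and its coefficient has modulus at most 1/2, so the first
  logarithm of \<open>homotopy\<close> never meets a singularity.\<close>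

lemma slope_factor_pos:
  fixes V y c h :: real
  assumes "V > 0" "y \<ge> 0" "h > 0" "\<bar>c\<bar> \<le> h"
  shows "1 + c / (2*h) * (1 - (V / (V + y))^2) > 0"
proof -
  have "V / (V + y) > 0" "V / (V + y) \<le> 1"
    using assms by auto
  then have u: "0 \<le> 1 - (V / (V + y))^2" "1 - (V / (V + y))^2 \<le> 1"
    by (auto simp: power_le_one)
  have "\<bar>c / (2*h)\<bar> \<le> 1/2"
    using assms by (simp add: abs_divide field_simps)
  then have "\<bar>c / (2*h)\<bar> * \<bar>1 - (V / (V + y))^2\<bar> \<le> 1/2 * 1"
    using u by (intro mult_mono) auto
  then have "\<bar>c / (2*h) * (1 - (V / (V + y))^2)\<bar> \<le> 1/2"
    by (simp only: abs_mult)
  then show ?thesis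
    by linarith
qed

text \<open>For \<open>s > 0\<close> the derivative times \<open>s\<close> is
  \<open>step_num\<close> for the step \<open>s*c\<close> and the hint \<open>s*h\<close>, divided
  by a positive product. At \<open>s = 0\<close> this says nothing about the sign, and only
  differentiability is claimed.\<close>

lemma homotopy_deriv:
  fixes V z c h e s :: real
  assumes V: "V > 0" and z: "z \<ge> 0" and h: "h > 0" and c: "\<bar>c\<bar> \<le> h"
    and e: "e^2 = 1" and s: "s \<ge> 0" and N: "e * (z + s*c) \<ge> 0"
  shows "\<exists>D. (homotopy V z c h e has_real_derivative D) (at s) \<and> (s > 0 \<longrightarrow> D \<ge> 0)"
proof -
  define n where "n = z + s*c"
  define A where "A = V + s*h*z"
  define W where "W = V + (s*c)^2"
  define B where "B = W + s*h*(e*n)"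
  define x where "x = 1 + c / (2*h) * (1 - (V / A)^2)"
  define X where "X = 2*A^2 + (s*c)*z*(2*V + s*h*z)"
  have A: "A > 0" and W: "W > 0"
    using V z h s by (auto simp: A_def W_def add_pos_nonneg)
  have B: "B > 0"
    using W h s N by (auto simp: B_def n_def add_pos_nonneg)
  have x: "x > 0"
    using slope_factor_pos[of V "s*h*z" h c] V z h c s by (simp add: x_def A_def)
  \<comment> \<open>This removes the \<open>h\<close> in the denominator of \<open>x\<close>;
    \<open>X\<close> is the polynomial that occurs in \<open>step_num\<close>.\<close>
  have X: "X = 2*A^2*x"
  proof -
    have "2*A^2*x = 2*A^2 + c / h * (A^2 - V^2)"
      using A h by (simp add: x_def field_simps)
    also have "A^2 - V^2 = h * (s*z*(2*V + s*h*z))"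
      by (simp add: A_def power2_eq_square algebra_simps)
    finally show ?thesis
      using h by (simp add: X_def)
  qed
  have Xpos: "X > 0"
    using A x by (simp add: X)
  have dU: "((\<lambda>s. V / (V + s*h*z)) has_real_derivative - (V * (h*z)) / A^2) (at s)"
    using A unfolding A_def by (auto intro!: derivative_eq_intros simp: power2_eq_square)
  have "((\<lambda>s. 1 + c / (2*h) * (1 - (V / (V + s*h*z))^2)) has_real_derivative
          c / (2*h) * (0 - of_nat 2 * (- (V * (h*z)) / A^2 * (V / A) ^ (2 - Suc 0)))) (at s)"
    unfolding A_def using DERIV_add[OF DERIV_const DERIV_cmult[OF DERIV_diff[OF DERIV_const
          DERIV_power[OF dU]]], of 1 "c / (2*h)" 1 2] by (simp add: A_def)
  also have "c / (2*h) * (0 - of_nat 2 * (- (V * (h*z)) / A^2 * (V / A) ^ (2 - Suc 0)))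
      = c*z*V^2 / A^3"
    using A h by (simp add: field_simps eval_nat_numeral)
  finally have dx: "((\<lambda>s. 1 + c / (2*h) * (1 - (V / (V + s*h*z))^2)) has_real_derivative
          c*z*V^2 / A^3) (at s)" .
  have "((\<lambda>s. ln (1 + c / (2*h) * (1 - (V / (V + s*h*z))^2))) has_real_derivative
          inverse x * (c*z*V^2 / A^3)) (at s)"
    using DERIV_chain2[OF DERIV_ln[OF x[unfolded x_def A_def]] dx]
    by (simp only: x_def[symmetric] A_def[symmetric])
  then have 1: "((\<lambda>s. ln (1 + c / (2*h) * (1 - (V / (V + s*h*z))^2))) has_real_derivative
          c*z*V^2 / A^3 / x) (at s)"
    by (simp only: divide_inverse mult.commute)
  have 2: "((\<lambda>s. (z + s*c)^2 / (2 * (V + (s*c)^2 + s*h*(e*(z + s*c))))) has_real_derivative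
          (2*c*n*B - n^2 * (2 * s * c^2 + h*(e*n) + s*h*(e*c))) / (2*B^2)) (at s)"
    using B unfolding B_def W_def n_def
    by (auto intro!: derivative_eq_intros simp: divide_simps) (simp add: algebra_simps power2_eq_square)
  have 3: "((\<lambda>s. ln (V + (s*c)^2) / 2) has_real_derivative s*c^2 / W) (at s)"
    using W unfolding W_def
    by (auto intro!: derivative_eq_intros simp: divide_simps power2_eq_square)
  have 4: "((\<lambda>s. z^2 / (2 * (V + s*h*z))) has_real_derivative - h*z^3 / (2*A^2)) (at s)"
    using A unfolding A_def
    by (auto intro!: derivative_eq_intros simp: divide_simps) (simp add: algebra_simps eval_nat_numeral)
  define D where "D = c*z*V^2 / A^3 / x
      - (2*c*n*B - n^2 * (2 * s * c^2 + h*(e*n) + s*h*(e*c))) / (2*B^2) + s*c^2 / W + - h*z^3 / (2*A^2)"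
  have D: "(homotopy V z c h e has_real_derivative D) (at s)"
    unfolding homotopy_def[abs_def] D_def by (intro DERIV_add DERIV_diff 1 2 3 4)
  have "D \<ge> 0" if "s > 0"
  proof -
    let ?p = "(s*c)*z" and ?N = "e*n"
    have N_abs: "?N = \<bar>z + s*c\<bar>"
      using N e by (auto simp: n_def power2_eq_1_iff)
    \<comment> \<open>The factor \<open>s\<close> lets \<open>c\<close> and \<open>h\<close> appear
      only as \<open>s*c\<close> and \<open>s*h\<close>, the arguments of
      \<open>step_num\<close>.\<close>
    have t1: "s * (c*z*V^2 / A^3 / x) = 2*?p*V^2 / (A*X)"
      using A x by (simp add: X field_simps eval_nat_numeral)
    have N2: "n^2 = ?N^2" 
      using e by (simp add: power_mult_distrib)
    have "s * (2*c*n*B - n^2 * (2 * s * c^2 + h*(e*n) + s*h*(e*c)))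
        = 2*(?p + (s*c)^2)*B - 2*(s*c)^2*n^2 - s*h*(e*n)*n^2 - s*h*(e*n)*(?p + (s*c)^2)"
      by (simp add: n_def algebra_simps power2_eq_square)
    also have "\<dots> = (?p + (s*c)^2)*(2*W + s*h*?N) - 2*(s*c)^2*?N^2 - s*h*?N^3"
      unfolding N2 B_def by (simp add: algebra_simps eval_nat_numeral)
    finally have t2: "s * ((2*c*n*B - n^2 * (2 * s * c^2 + h*(e*n) + s*h*(e*c))) / (2*B^2))
        = ((?p + (s*c)^2)*(2*W + s*h*?N) - 2*(s*c)^2*?N^2 - s*h*?N^3) / (2*B^2)"
      by simp
    have "s * D = s * (c*z*V^2 / A^3 / x)
        - s * ((2*c*n*B - n^2 * (2 * s * c^2 + h*(e*n) + s*h*(e*c))) / (2*B^2))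
        + (s*c)^2 / W - s*h*z^3 / (2*A^2)"
      unfolding D_def distrib_left right_diff_distrib by (simp add: power2_eq_square mult_ac)
    also have "\<dots> = 2*?p*V^2 / (A*X)
        - ((?p + (s*c)^2)*(2*W + s*h*?N) - 2*(s*c)^2*?N^2 - s*h*?N^3) / (2*B^2)
        + (s*c)^2 / W - s*h*z^3 / (2*A^2)"
      by (simp only: t1 t2)
    also have "\<dots> = step_num V z ?N (s*c) (s*h) / (2*A^2*X*W*B^2)"
    proof -
      have "step_num V z ?N (s*c) (s*h) = 2*(2*?p*V^2)*A*W*B^2 + 2*(s*c)^2*A^2*X*B^2
          - ((?p + (s*c)^2)*(2*W + s*h*?N) - 2*(s*c)^2*?N^2 - s*h*?N^3)*A^2*X*W
          - s*h*z^3*X*W*B^2"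
        unfolding step_num_def Let_def A_def[symmetric] W_def[symmetric] B_def[symmetric]
          X_def[symmetric]
        by algebra
      \<comment> \<open>With atomic numerators, clearing the denominators does not expand the large
        polynomials.\<close>
      moreover have "P/(A*X) - R/(2*B^2) + q/W - k/(2*A^2)
          = (2*P*A*W*B^2 + 2*q*A^2*X*B^2 - R*A^2*X*W - k*X*W*B^2) / (2*A^2*X*W*B^2)" for P R q k
        using A B W Xpos by (simp add: divide_simps) (simp add: algebra_simps power2_eq_square)
      ultimately show ?thesis
        by (simp only:)
    qed
    also have "\<dots> \<ge> 0"
    proof -
      have "\<bar>s*c\<bar> \<le> s*h"
        using c s by (simp add: abs_mult mult_left_mono)
      then show ?thesis
        unfolding N_abs using step_num_nonneg[of V z "s*c" "s*h"] V z A W Xpos B by simp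
    qed
    finally show "D \<ge> 0"
      using that by (simp add: zero_le_mult_iff)
  qed
  with D show ?thesis by blast
qed

text \<open>The sign \<open>e\<close> stays valid along the whole interval. Monotonicity asks for
  the sign of the derivative only inside it, which suits a left end at 0.\<close>

lemma homotopy_mono:
  fixes V z c h e a b :: real
  assumes V: "V > 0" and z: "z \<ge> 0" and h: "h > 0" and c: "\<bar>c\<bar> \<le> h"
    and e: "e^2 = 1" and ab: "0 \<le> a" "a \<le> b"
    and N: "\<And>s. a \<le> s \<Longrightarrow> s \<le> b \<Longrightarrow> e * (z + s*c) \<ge> 0"
  shows "homotopy V z c h e a \<le> homotopy V z c h e b"
proof (rule DERIV_nonneg_imp_increasing_open[OF ab(2)])
  have D: "\<exists>D. (homotopy V z c h e has_real_derivative D) (at s) \<and> (s > 0 \<longrightarrow> D \<ge> 0)"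
    if "a \<le> s" "s \<le> b" for s
    using that ab N by (intro homotopy_deriv[OF V z h c e]) auto
  show "\<exists>D. (homotopy V z c h e has_real_derivative D) (at s) \<and> D \<ge> 0" if "a < s" "s < b" for s
    using D[of s] that ab by auto
  show "continuous_on {a..b} (homotopy V z c h e)"
  proof (rule continuous_at_imp_continuous_on, rule ballI)
    fix s assume "s \<in> {a..b}"
    then show "isCont (homotopy V z c h e) s"
      using D[of s] DERIV_isCont by auto
  qed
qed

lemma collinear_step_log:
  fixes V z c h :: real
  assumes V: "V > 0" and z: "z \<ge> 0" and h: "h > 0" and c: "\<bar>c\<bar> \<le> h"
  shows "(z + c)^2 / (2 * (V + c^2 + h*\<bar>z + c\<bar>)) - ln (V + c^2) / 2
    \<le> z^2 / (2 * (V + h*z)) - ln V / 2 + ln (1 + c / (2*h) * (1 - (V / (V + h*z))^2))"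
proof -
  have start: "homotopy V z c h 1 0 = ln V / 2"
    using V by (simp add: homotopy_def)
  have "ln V / 2 \<le> homotopy V z c h (if z + c \<ge> 0 then 1 else -1) 1" (is "_ \<le> homotopy _ _ _ _ ?e _")
  proof (cases "z + c \<ge> 0")
    case True
    have "1 * (z + s*c) \<ge> 0" if "0 \<le> s" "s \<le> 1" for s
    proof -
      have "z + s*c = (1 - s)*z + s*(z + c)" by (simp add: algebra_simps)
      then show ?thesis using True z that by simp
    qed
    then have "homotopy V z c h 1 0 \<le> homotopy V z c h 1 1"
      by (intro homotopy_mono V z h c) auto
    with True start show ?thesis by simp
  next
    case False
    then have cneg: "c < 0" using z by simp
    \<comment> \<open>The point \<open>z + s*c\<close> reaches the origin at \<open>s0\<close>,
      where \<open>e\<close> switches. Both versions of \<open>homotopy\<close> agree there, since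
      \<open>e\<close> occurs only as a factor of \<open>z + s0*c = 0\<close>.\<close>
    define s0 where "s0 = z / (-c)"
    have s0: "0 \<le> s0" "s0 \<le> 1" and s0c: "z + s0*c = 0"
      using cneg z False by (auto simp: s0_def field_simps)
    have shift: "z + s*c = (s - s0)*c" for s
      using s0c by (simp add: algebra_simps)
    have "homotopy V z c h 1 0 \<le> homotopy V z c h 1 s0"
      using s0 cneg by (intro homotopy_mono V z h c) (auto simp: shift mult_nonpos_nonpos)
    also have "\<dots> = homotopy V z c h (-1) s0"
      by (simp add: homotopy_def s0c)
    also have "\<dots> \<le> homotopy V z c h (-1) 1"
      using s0 cneg by (intro homotopy_mono V z h c) (auto simp: shift mult_nonneg_nonpos)
    finally show ?thesis using False start by simp
  qed
  also have "homotopy V z c h ?e 1 = ln (1 + c / (2*h) * (1 - (V / (V + h*z))^2))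
      - (z + c)^2 / (2 * (V + c^2 + h*\<bar>z + c\<bar>)) + ln (V + c^2) / 2 + z^2 / (2 * (V + h*z))"
  proof -
    have "?e * (z + c) = \<bar>z + c\<bar>" by simp
    then show ?thesis by (simp only: homotopy_def mult_1)
  qed
  finally show ?thesis
    by linarith
qed

subsection \<open>The potential\<close>

definition potential :: "real \<Rightarrow> real \<Rightarrow> real \<Rightarrow> real" where
  "potential V h z = exp (z^2 / (2*V + 2*h*z)) / sqrt V"

lemma potential_altdef: "V > 0 \<Longrightarrow> potential V h z = exp (z^2 / (2 * (V + h*z)) - ln V / 2)"
  by (simp add: potential_def exp_diff ln_sqrt[symmetric] algebra_simps)

lemma potential_pos: "V > 0 \<Longrightarrow> potential V h z > 0"
  by (simp add: potential_def)

lemma potential_antimono: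
  assumes "V > 0" "z \<ge> 0" "0 \<le> h" "h \<le> h'"
  shows "potential V h' z \<le> potential V h z"
proof -
  have "z^2 / (2*V + 2*h'*z) \<le> z^2 / (2*V + 2*h*z)"
    using assms by (intro divide_left_mono mult_pos_pos add_mono mult_right_mono)
      (auto intro: add_pos_nonneg)
  then show ?thesis
    using assms by (simp add: potential_def divide_right_mono)
qed

lemma potential_collinear_step:
  assumes V: "V > 0" and z: "z \<ge> 0" and h: "h > 0" and c: "\<bar>c\<bar> \<le> h"
  shows "potential (V + c^2) h \<bar>z + c\<bar>
    \<le> potential V h z * (1 + c*z * ((2*V + h*z) / (2 * (V + h*z)^2)))"
proof -
  define x where "x = 1 + c / (2*h) * (1 - (V / (V + h*z))^2)"
  have x: "x > 0"
    unfolding x_def using assms by (intro slope_factor_pos) auto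
  have A: "V + h*z > 0"
    using V z h by (simp add: add_pos_nonneg)
  \<comment> \<open>Cancelling \<open>h\<close> turns the linear factor into the coefficient used by
    \<open>free_range\<close>.\<close>
  have "1 - (V / (V + h*z))^2 = h*z * (2*V + h*z) / (V + h*z)^2"
    using A by (simp add: field_simps) (simp add: power2_eq_square algebra_simps)
  then have xeq: "x = 1 + c*z * ((2*V + h*z) / (2 * (V + h*z)^2))"
    using h by (simp add: x_def)
  have "potential (V + c^2) h \<bar>z + c\<bar>
      \<le> exp (z^2 / (2 * (V + h*z)) - ln V / 2 + ln x)"
    using collinear_step_log[OF assms] V by (simp add: potential_altdef add_pos_nonneg x_def)
  also have "\<dots> = potential V h z * x"
    using V x by (simp add: potential_altdef exp_add)
  finally show ?thesis by (simp only: xeq)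
qed

text \<open>Here \<open>t\<close> is the squared length of the orthogonal component. It raises the
  exponent by at most \<open>t / (2 * (V + t))\<close>, and \<open>ln u \<le> u - 1\<close> at
  \<open>u = V / (V + t)\<close> shows that the term \<open>ln V / 2\<close> grows by at least as
  much.\<close>

lemma potential_orthogonal_step:
  assumes V: "V > 0" and y: "y \<ge> 0" and h: "h \<ge> 0" and t: "t \<ge> 0"
  shows "potential (V + t) h (sqrt (y^2 + t)) \<le> potential V h y"
proof -
  have hy: "h*y \<ge> 0" using h y by simp
  have "sqrt (y^2 + t) \<ge> y"
    using t by (simp add: real_le_rsqrt)
  then have "(y^2 + t) / (2 * (V + t + h * sqrt (y^2 + t))) \<le> (y^2 + t) / (2 * (V + t + h*y))"
    using V t h hy y by (intro divide_left_mono mult_pos_pos) (auto intro!: add_pos_nonneg mult_left_mono)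
  also have "\<dots> \<le> y^2 / (2 * (V + h*y)) + t / (2 * (V + t))"
  proof -
    have "(y^2 + t) / (V + t + h*y) - y^2 / (V + h*y)
        = (t * (V + h*y) - t * y^2) / ((V + t + h*y) * (V + h*y))"
      using V t hy by (simp add: divide_simps) (simp add: algebra_simps)
    also have "\<dots> \<le> (t * (V + h*y)) / ((V + t + h*y) * (V + h*y))"
      using V t hy by (intro divide_right_mono) auto
    also have "\<dots> = t / (V + t + h*y)"
      using V hy by simp
    also have "\<dots> \<le> t / (V + t)"
      using V t hy by (intro divide_left_mono mult_pos_pos) auto
    finally have "(y^2 + t) / (V + t + h*y) \<le> y^2 / (V + h*y) + t / (V + t)"
      by (simp only: diff_le_eq add.commute)
    then have "(y^2 + t) / (V + t + h*y) / 2 \<le> (y^2 / (V + h*y) + t / (V + t)) / 2"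
      by (rule divide_right_mono) simp
    then show ?thesis
      by (simp only: add_divide_distrib divide_divide_eq_left mult.commute[of _ 2])
  qed
  also have "t / (2 * (V + t)) \<le> ln (V + t) / 2 - ln V / 2"
  proof -
    have "ln (V / (V + t)) \<le> V / (V + t) - 1"
      using V t by (intro ln_le_minus_one) auto
    also have "\<dots> = - (t / (V + t))"
      using V t by (simp add: field_simps)
    finally have "t / (V + t) \<le> ln (V + t) - ln V"
      using V t by (simp add: ln_div)
    then have "t / (V + t) / 2 \<le> (ln (V + t) - ln V) / 2"
      by (rule divide_right_mono) simp
    then show ?thesis
      by (simp only: diff_divide_distrib divide_divide_eq_left mult.commute[of _ 2])
  qed
  finally show ?thesis
    using V t by (simp add: potential_altdef)
qed

lemma potential_step:
  fixes G v :: "'a::real_inner"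
  assumes V: "V > 0" and h: "h > 0" and v: "norm v \<le> h"
  shows "potential (V + (norm v)^2) h (norm (G + v))
    \<le> potential V h (norm G)
      * (1 + (v \<bullet> G) * ((2*V + h * norm G) / (2 * (V + h * norm G)^2)))"
proof -
  \<comment> \<open>The signed length of the component of \<open>v\<close> along \<open>G\<close>.
    For \<open>G = 0\<close>, division by zero gives \<open>c = 0\<close>, and all of
    \<open>v\<close> counts as orthogonal.\<close>
  define c where "c = (v \<bullet> G) / norm G"
  define t where "t = (norm v)^2 - c^2"
  have cz: "c * norm G = v \<bullet> G"
    by (simp add: c_def)
  have cv: "\<bar>c\<bar> \<le> norm v"
    unfolding c_def using Cauchy_Schwarz_ineq2[of v G]
    by (cases "norm G = 0") (auto simp: abs_divide field_simps)
  then have t: "t \<ge> 0"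
    unfolding t_def using abs_le_square_iff[of c "norm v"] by simp
  have "(norm (G + v))^2 = \<bar>norm G + c\<bar>^2 + t"
    using cz by (simp add: t_def power2_norm_eq_inner inner_simps inner_commute
        power2_sum algebra_simps)
  then have n: "norm (G + v) = sqrt (\<bar>norm G + c\<bar>^2 + t)"
    by (metis norm_ge_zero real_sqrt_unique)
  have Vt: "V + (norm v)^2 = (V + c^2) + t"
    by (simp add: t_def)
  have "potential (V + (norm v)^2) h (norm (G + v)) \<le> potential (V + c^2) h \<bar>norm G + c\<bar>"
    unfolding n Vt using V h t by (intro potential_orthogonal_step) (auto simp: add_pos_nonneg)
  also have "\<dots> \<le> potential V h (norm G)
      * (1 + c * norm G * ((2*V + h * norm G) / (2 * (V + h * norm G)^2)))"
    using cv v by (intro potential_collinear_step V h) auto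
  finally show ?thesis by (simp only: cz)
qed

subsection \<open>The conjugate of the potential\<close>

lemma ln_plus_nonneg: "ln_plus x \<ge> 0"
  by (simp add: ln_plus_def)

lemma ln_plus_mono: "0 \<le> x \<Longrightarrow> x \<le> y \<Longrightarrow> ln_plus x \<le> ln_plus y"
  by (auto simp: ln_plus_def max_def)

lemma le_exp_ln_plus: "x \<ge> 0 \<Longrightarrow> x \<le> exp (ln_plus x)"
  by (cases "x > 0") (auto simp: ln_plus_def max_def)

text \<open>Factor \<open>exp u\<close> as \<open>exp (ln_plus y) * exp (u - ln_plus y)\<close>: the
  first factor is at least \<open>y\<close>, the second at least
  \<open>u - ln_plus y\<close>.\<close>

lemma linear_minus_exp_le:
  assumes "y \<ge> 0"
  shows "y * u - exp u \<le> y * ln_plus y"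
proof -
  have "y * (u - ln_plus y) \<le> exp u"
  proof (cases "u \<ge> ln_plus y")
    case True
    have "y * (u - ln_plus y) \<le> exp (ln_plus y) * exp (u - ln_plus y)"
      using True exp_ge_add_one_self[of "u - ln_plus y"] le_exp_ln_plus[OF assms] assms
      by (intro mult_mono) linarith+
    then show ?thesis by (simp add: exp_add[symmetric])
  next
    case False
    then have "y * (u - ln_plus y) \<le> 0"
      using assms by (intro mult_nonneg_nonpos) auto
    also have "0 \<le> exp u" by simp
    finally show ?thesis .
  qed
  then show ?thesis by (simp add: algebra_simps)
qed

text \<open>With \<open>v = sqrt (ln_plus y)\<close>, factor \<open>exp (u^2)\<close> as
  \<open>exp (v^2) * exp (u^2 - v^2)\<close>. The first factor is at least \<open>y\<close>; for
  \<open>u \<ge> v\<close> the second is at least \<open>1 + (u - v)^2\<close>, hence at least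
  \<open>u - v\<close>.\<close>

lemma linear_minus_exp_square_le:
  assumes "y \<ge> 0" "u \<ge> 0"
  shows "y * u - exp (u^2) \<le> y * sqrt (ln_plus y)"
proof -
  define v where "v = sqrt (ln_plus y)"
  have v: "v \<ge> 0" "v^2 = ln_plus y"
    by (simp_all add: v_def ln_plus_nonneg)
  have "y * (u - v) \<le> exp (u^2)"
  proof (cases "u \<ge> v")
    case True
    have "u - v \<le> 1 + (u - v)^2"
      using sum_squares_bound[of "u - v" 1] True by simp
    also have "(u - v)^2 \<le> u^2 - v^2"
    proof -
      have "u^2 - v^2 - (u - v)^2 = 2 * v * (u - v)"
        by (simp add: power2_eq_square algebra_simps)
      then show ?thesis using True v by (smt (verit) mult_nonneg_nonneg)
    qed
    also have "1 + (u^2 - v^2) \<le> exp (u^2 - v^2)"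
      by (rule exp_ge_add_one_self)
    finally have "y * (u - v) \<le> exp (v^2) * exp (u^2 - v^2)"
      using True le_exp_ln_plus[OF assms(1)] assms v by (intro mult_mono) auto
    then show ?thesis by (simp add: exp_add[symmetric])
  next
    case False
    then have "y * (u - v) \<le> 0"
      using assms by (intro mult_nonneg_nonpos) auto
    also have "0 \<le> exp (u^2)" by simp
    finally show ?thesis .
  qed
  then show ?thesis by (simp add: algebra_simps v_def)
qed

text \<open>The potential has two regimes: for \<open>h*z \<le> V\<close> its exponent is at least
  \<open>z^2 / (4*V)\<close>, otherwise at least \<open>z / (4*h)\<close>. Each regime yields one
  summand of the bound, and the other summand is nonnegative.\<close>

lemma potential_conjugate_le:
  assumes V: "V > 0" and h: "h > 0" and k: "k > 0" and x: "x \<ge> 0" and z: "z \<ge> 0"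
  shows "x * z - k^2 * potential V h z
    \<le> 2 * x * sqrt (V * ln_plus (2 * x * V / k^2)) + 4 * h * x * ln_plus (4 * h * x * sqrt V / k^2)"
proof -
  define K where "K = k^2 / sqrt V"
  have K: "K > 0" using k V by (simp add: K_def)
  have sV: "sqrt V * sqrt V = V" "sqrt V > 0" using V by simp_all
  have \<Phi>: "k^2 * potential V h z = K * exp (z^2 / (2*V + 2*h*z))"
    by (simp add: potential_def K_def)
  show ?thesis
  proof (cases "h*z \<le> V")
    case True
    \<comment> \<open>Here \<open>u^2\<close> is the lower bound on the exponent, and
      \<open>y\<close> is chosen such that \<open>K * y * u = x * z\<close>.\<close>
    define u where "u = z / (2 * sqrt V)"
    define y where "y = 2 * x * sqrt V / K"
    have y: "y \<ge> 0" "y = 2 * x * V / k^2"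
      using x K V sV by (simp_all add: y_def K_def)
    have "u^2 = z^2 / (4*V)"
      using V by (simp add: u_def power_divide power_mult_distrib)
    also have "\<dots> \<le> z^2 / (2*V + 2*h*z)"
      using True V h z by (intro divide_left_mono mult_pos_pos) (auto intro: add_pos_nonneg)
    finally have "K * exp (u^2) \<le> k^2 * potential V h z"
      using K by (simp add: \<Phi>)
    moreover have "K * y * u = x * z"
      using K sV by (simp add: y_def u_def)
    ultimately have "x * z - k^2 * potential V h z \<le> K * (y * u - exp (u^2))"
      by (simp add: algebra_simps)
    also have "\<dots> \<le> K * (y * sqrt (ln_plus y))"
      using K y z sV by (intro mult_left_mono linear_minus_exp_square_le) (auto simp: u_def)
    also have "\<dots> = 2 * x * sqrt (V * ln_plus y)"
      using K by (simp add: y_def real_sqrt_mult)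
    finally have "x * z - k^2 * potential V h z \<le> 2 * x * sqrt (V * ln_plus (2 * x * V / k^2))"
      by (simp only: y)
    moreover have "0 \<le> 4 * h * x * ln_plus (4 * h * x * sqrt V / k^2)"
      using h x by (simp add: ln_plus_nonneg)
    ultimately show ?thesis by linarith
  next
    case False
    define u where "u = z / (4 * h)"
    define y where "y = 4 * h * x / K"
    have y: "y \<ge> 0" "y = 4 * h * x * sqrt V / k^2"
      using x h K V by (simp_all add: y_def K_def)
    have zpos: "z > 0" using False V z h by (cases "z = 0") auto
    have "u = z^2 / (4*h*z)"
      using h zpos by (simp add: u_def power2_eq_square)
    also have "\<dots> \<le> z^2 / (2*V + 2*h*z)"
      using False V h zpos by (intro divide_left_mono mult_pos_pos) (auto intro: add_pos_nonneg)
    finally have "K * exp u \<le> k^2 * potential V h z"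
      using K by (simp add: \<Phi>)
    moreover have "K * y * u = x * z"
      using K h by (simp add: y_def u_def)
    ultimately have "x * z - k^2 * potential V h z \<le> K * (y * u - exp u)"
      by (simp add: algebra_simps)
    also have "\<dots> \<le> K * (y * ln_plus y)"
      using K y by (intro mult_left_mono linear_minus_exp_le) auto
    also have "\<dots> = 4 * h * x * ln_plus y"
      using K by (simp add: y_def)
    finally have "x * z - k^2 * potential V h z \<le> 4 * h * x * ln_plus (4 * h * x * sqrt V / k^2)"
      by (simp only: y)
    moreover have "0 \<le> 2 * x * sqrt (V * ln_plus (2 * x * V / k^2))"
      using x V by (simp add: ln_plus_nonneg)
    ultimately show ?thesis by linarith
  qed
qed

subsection \<open>Restarts and epochs\<close>

text \<open>Merges the variance terms of the last two epochs; the factor 2 under the root in the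
  theorem comes from here.\<close>

lemma sqrt_add_sqrt_le:
  fixes p q :: real
  assumes "p \<ge> 0" "q \<ge> 0"
  shows "sqrt p + sqrt q \<le> sqrt (2 * (p + q))"
  using assms sum_squares_bound[of "sqrt p" "sqrt q"]
  by (intro real_le_rsqrt) (simp add: power2_sum)

locale hinted_sequence =
  fixes g :: "nat \<Rightarrow> 'a::real_inner" and h :: "nat \<Rightarrow> real"
  assumes hint_first: "h 1 > 0"
    and hint_mono: "\<And>s t. 1 \<le> s \<Longrightarrow> s \<le> t \<Longrightarrow> h s \<le> h t"
    and norm_le_hint: "\<And>t. t \<ge> 1 \<Longrightarrow> norm (g t) \<le> h t"
begin

abbreviation "\<tau> \<equiv> restart_round g h"

text \<open>The threshold of the restart test in round \<open>t\<close>, whose squares add up to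
  half of \<open>b_total\<close>.\<close>

definition ratio_sum :: "nat \<Rightarrow> real" where
  "ratio_sum t = (\<Sum>s = 1..<t. norm (g s) / h s) + 2"

lemma hint_pos: "t \<ge> 1 \<Longrightarrow> h t > 0"
  using hint_first hint_mono[of 1 t] by simp

lemma ratio_sum_ge_2: "ratio_sum t \<ge> 2"
proof -
  have "(\<Sum>s = 1..<t. norm (g s) / h s) \<ge> 0"
    using hint_pos by (intro sum_nonneg) (simp add: less_imp_le)
  then show ?thesis by (simp add: ratio_sum_def)
qed

lemma ratio_sum_le: "t \<ge> 1 \<Longrightarrow> ratio_sum t \<le> real t + 1"
proof -
  assume t: "t \<ge> 1"
  have "(\<Sum>s = 1..<t. norm (g s) / h s) \<le> (\<Sum>s = 1..<t. 1)"
    using hint_pos norm_le_hint by (intro sum_mono) simp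
  then show ?thesis using t by (simp add: ratio_sum_def of_nat_diff)
qed

lemma restart_round_Suc:
  "\<tau> (Suc n) = (if h (Suc n) / h (\<tau> n) > ratio_sum (Suc n) then Suc n else \<tau> n)"
  by (simp add: ratio_sum_def atLeastLessThanSuc_atLeastAtMost)

declare restart_round.simps(2) [simp del]

lemma restart_round_ge_1: "\<tau> t \<ge> 1"
  by (induction t) (auto simp: restart_round_Suc)

lemma restart_round_1: "\<tau> 1 = 1"
  using restart_round_Suc[of 0] by simp

lemma restart_round_le: "t \<ge> 1 \<Longrightarrow> \<tau> t \<le> t"
proof (induction t rule: nat_induct_at_least)
  case base
  show ?case by (simp only: restart_round_1)
next
  case (Suc n)
  then show ?case by (simp add: restart_round_Suc)
qed

text \<open>A restart in round \<open>Suc n\<close> would leave only \<open>s = Suc n\<close> in the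
  interval; without one, the induction hypothesis applies.\<close>

lemma restart_round_epoch: "t \<ge> 1 \<Longrightarrow> s \<in> {\<tau> t..t} \<Longrightarrow> \<tau> s = \<tau> t"
proof (induction t arbitrary: s rule: nat_induct_at_least)
  case base
  then have "s = 1" by (simp only: restart_round_1) simp
  then show ?case by simp
next
  case (Suc n)
  show ?case
  proof (cases "s = Suc n")
    case False
    with Suc.prems have "\<tau> (Suc n) = \<tau> n"
      by (auto simp: restart_round_Suc split: if_splits)
    with Suc.prems Suc.IH[of s] False show ?thesis by simp
  qed simp
qed

text \<open>Without a restart in round \<open>t\<close> this is the failed test. With one,
  \<open>\<tau> t = t\<close> and the threshold is at least 2.\<close>

lemma hint_le_restart:
  assumes "t \<ge> 1"
  shows "h t \<le> h (\<tau> t) * ratio_sum t"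
proof -
  obtain n where n: "t = Suc n" using assms by (cases t) auto
  have pos: "h (\<tau> n) > 0" "h t > 0"
    using hint_pos restart_round_ge_1 assms by auto
  show ?thesis
  proof (cases "h t / h (\<tau> n) > ratio_sum t")
    case True
    then have "\<tau> t = t" by (simp add: n restart_round_Suc)
    then show ?thesis
      using mult_left_mono[of 1 "ratio_sum t" "h t"] pos ratio_sum_ge_2[of t] by simp
  next
    case False
    then have "\<tau> t = \<tau> n" by (simp add: n restart_round_Suc)
    with False show ?thesis
      using pos by (simp add: field_simps not_less)
  qed
qed

text \<open>For \<open>t > 1\<close>, \<open>\<tau> t = t\<close> means that the test succeeded in
  round \<open>t\<close>, because \<open>\<tau> (t - 1) \<le> t - 1\<close>.\<close>

lemma restart_jump:
  assumes "\<tau> t = t" "t > 1"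
  shows "h (\<tau> (t - 1)) * ratio_sum t < h t"
proof -
  obtain n where n: "t = Suc n" "n \<ge> 1" using assms(2) by (cases t) auto
  have "\<tau> n \<noteq> Suc n" using restart_round_le[OF n(2)] by simp
  with assms n have "h t / h (\<tau> n) > ratio_sum t"
    by (auto simp: restart_round_Suc split: if_splits)
  then show ?thesis
    using n hint_pos[of "\<tau> n"] restart_round_ge_1[of n] by (simp add: field_simps)
qed

lemma restart_doubles:
  assumes "\<tau> t = t" "t > 1"
  shows "2 * h (\<tau> (t - 1)) \<le> h t"
proof -
  have "h (\<tau> (t - 1)) * 2 \<le> h (\<tau> (t - 1)) * ratio_sum t"
    using ratio_sum_ge_2 hint_pos[OF restart_round_ge_1] by (intro mult_left_mono) (auto simp: less_imp_le)
  then show ?thesis using restart_jump[OF assms] by simp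
qed

section \<open>Cubic growth of \<open>b_total\<close>\<close>

lemma b_total_eq: "b_total g h T = 2 * (\<Sum>t = 1..T. (ratio_sum t)^2)"
  by (simp add: b_total_def ratio_sum_def)

lemma b_total_le_cube: "T \<ge> 1 \<Longrightarrow> b_total g h T \<le> (real T + 1)^3"
proof (induction T rule: nat_induct_at_least)
  case base
  then show ?case by (simp add: b_total_eq ratio_sum_def)
next
  case (Suc n)
  have "(ratio_sum (Suc n))^2 \<le> (real n + 2)^2"
    using ratio_sum_le[of "Suc n"] ratio_sum_ge_2[of "Suc n"] by (intro power_mono) auto
  then have "b_total g h (Suc n) \<le> (real n + 1)^3 + 2 * (real n + 2)^2"
    using Suc.IH by (simp add: b_total_eq)
  \<comment> \<open>The last bracket is the increment of the cube from \<open>n + 1\<close> to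
    \<open>n + 2\<close>; the comparison reduces to \<open>1 \<le> n^2 + n\<close>.\<close>
  also have "\<dots> \<le> (real n + 1)^3 + (3 * (real n)^2 + 9 * real n + 7)"
  proof -
    have "real n \<ge> 1" "(real n)^2 \<ge> 1"
      using Suc.hyps by (simp_all add: one_le_power)
    moreover have "(real n + 2)^2 = (real n)^2 + 4 * real n + 4"
      by (simp add: power2_sum)
    ultimately show ?thesis
      by linarith
  qed
  also have "\<dots> = (real (Suc n) + 1)^3"
    by (simp add: power2_eq_square power3_eq_cube algebra_simps)
  finally show ?case .
qed

section \<open>Losses by telescoping the potential\<close>

lemma round_loss_le:
  fixes t
  defines "a \<equiv> \<tau> t"
  defines "V \<equiv> (h a)^2 + (\<Sum>s = a..<t. (norm (g s))^2)" and "G \<equiv> (\<Sum>s = a..<t. g s)"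
  assumes t: "t \<ge> 1"
  shows "g t \<bullet> free_range g h t
    \<le> (h a)^2 * (potential V (h t) (norm G) - potential (V + (norm (g t))^2) (h t) (norm (G + g t)))"
proof -
  have ha: "h a > 0" "h t > 0"
    using hint_pos restart_round_ge_1 t by (auto simp: a_def)
  have V: "V > 0"
    unfolding V_def using ha by (intro add_pos_nonneg sum_nonneg) auto
  let ?k = "(2*V + h t * norm G) / (2 * (V + h t * norm G)^2)"
  \<comment> \<open>The output is \<open>- (h a)^2\<close> times the gradient of the potential, so
    \<open>potential_step\<close> bounds the loss by a drop of the potential at the same hint
    \<open>h t\<close>.\<close>
  have "free_range g h t = ((h a)^2 * potential V (h t) (norm G) * ?k) *\<^sub>R (- G)"
    by (simp add: free_range_def Let_def a_def V_def G_def potential_def mult_ac)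
  then have "g t \<bullet> free_range g h t
      = (h a)^2 * (- potential V (h t) (norm G) * ((g t \<bullet> G) * ?k))"
    by (simp add: mult_ac)
  also have "\<dots> \<le> (h a)^2 * (potential V (h t) (norm G)
      - potential (V + (norm (g t))^2) (h t) (norm (G + g t)))"
  proof (rule mult_left_mono)
    show "- potential V (h t) (norm G) * ((g t \<bullet> G) * ?k)
        \<le> potential V (h t) (norm G) - potential (V + (norm (g t))^2) (h t) (norm (G + g t))"
      using potential_step[OF V ha(2) norm_le_hint[OF t], of G]
      unfolding distrib_left mult_1_right mult_minus_left by linarith
  qed simp
  finally show ?thesis .
qed

text \<open>The hint \<open>H\<close> is left general so that the induction hypothesis can be used
  at the hint \<open>h n\<close> of the next round, where the potentials cancel;
  \<open>potential_antimono\<close> then passes to a larger \<open>H\<close>.\<close>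

lemma epoch_loss_le:
  assumes "n \<ge> a" and "a \<ge> 1"
    and "\<And>t. t \<in> {a..<n} \<Longrightarrow> \<tau> t = a" and "\<And>t. t \<in> {a..<n} \<Longrightarrow> h t \<le> H" and "H > 0"
  shows "(\<Sum>t = a..<n. g t \<bullet> free_range g h t)
    \<le> h a - (h a)^2 * potential ((h a)^2 + (\<Sum>t = a..<n. (norm (g t))^2)) H (norm (\<Sum>t = a..<n. g t))"
  using assms
proof (induction n arbitrary: H rule: nat_induct_at_least)
  case base
  \<comment> \<open>In the empty epoch the potential is \<open>1 / h a\<close>, and both sides are
    0.\<close>
  then show ?case using hint_pos[of a] by (simp add: potential_def power2_eq_square)
next
  case (Suc n)
  let ?V = "\<lambda>n. (h a)^2 + (\<Sum>t = a..<n. (norm (g t))^2)" and ?G = "\<lambda>n. \<Sum>t = a..<n. g t"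
  have n: "n \<ge> 1" "\<tau> n = a" "h n \<le> H" "h n > 0" "h a > 0"
    using Suc.prems Suc.hyps hint_pos[of n] hint_pos[of a] by auto
  have V: "?V (Suc n) > 0"
    using n by (intro add_pos_nonneg sum_nonneg) auto
  have "(\<Sum>t = a..<n. g t \<bullet> free_range g h t) \<le> h a - (h a)^2 * potential (?V n) (h n) (norm (?G n))"
    using Suc.prems n hint_mono by (intro Suc.IH) auto
  moreover have "g n \<bullet> free_range g h n
      \<le> (h a)^2 * (potential (?V n) (h n) (norm (?G n)) - potential (?V (Suc n)) (h n) (norm (?G (Suc n))))"
    using round_loss_le[OF n(1)] Suc.hyps by (simp add: n(2) add_ac)
  moreover have "(h a)^2 * potential (?V (Suc n)) H (norm (?G (Suc n)))
      \<le> (h a)^2 * potential (?V (Suc n)) (h n) (norm (?G (Suc n)))"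
    using V n by (intro mult_left_mono potential_antimono) auto
  ultimately show ?case
    using Suc.hyps by (simp add: right_diff_distrib)
qed

lemma epoch_loss_le_hint:
  assumes "1 \<le> a" "a \<le> n" "\<And>t. t \<in> {a..n} \<Longrightarrow> \<tau> t = a"
  shows "(\<Sum>t = a..n. g t \<bullet> free_range g h t) \<le> h a"
proof -
  have "(\<Sum>t = a..<Suc n. g t \<bullet> free_range g h t)
      \<le> h a - (h a)^2 * potential ((h a)^2 + (\<Sum>t = a..<Suc n. (norm (g t))^2)) (h n) (norm (\<Sum>t = a..<Suc n. g t))"
    using assms hint_mono hint_pos[of n] by (intro epoch_loss_le) auto
  moreover have "(h a)^2 * potential ((h a)^2 + (\<Sum>t = a..<Suc n. (norm (g t))^2)) (h n)
      (norm (\<Sum>t = a..<Suc n. g t)) \<ge> 0"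
    using hint_pos[OF assms(1)]
    by (intro mult_nonneg_nonneg less_imp_le[OF potential_pos] add_pos_nonneg sum_nonneg) auto
  ultimately show ?thesis
    by (simp add: atLeastLessThanSuc_atLeastAtMost)
qed

text \<open>Induction over epochs: the losses before the last restart are at most \<open>h a\<close>
  by \<open>restart_doubles\<close>, and the current epoch adds at most another
  \<open>h a\<close>.\<close>

lemma total_loss_le: "t \<ge> 1 \<Longrightarrow> (\<Sum>s = 1..t. g s \<bullet> free_range g h s) \<le> 2 * h (\<tau> t)"
proof (induction t rule: less_induct)
  case (less t)
  define a where "a = \<tau> t"
  have a: "1 \<le> a" "a \<le> t"
    using restart_round_ge_1 restart_round_le less.prems by (auto simp: a_def)
  have epoch: "\<tau> s = a" if "s \<in> {a..t}" for s
    using restart_round_epoch less.prems that unfolding a_def by blast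
  have last: "(\<Sum>s = a..t. g s \<bullet> free_range g h s) \<le> h a"
    using a epoch by (rule epoch_loss_le_hint)
  show ?case
  proof (cases "a = 1")
    case True
    with last hint_pos[OF a(1)] show ?thesis unfolding a_def[symmetric] by simp
  next
    case False
    with a have "(\<Sum>s = 1..a - 1. g s \<bullet> free_range g h s) \<le> 2 * h (\<tau> (a - 1))"
      by (intro less.IH) auto
    also have "\<dots> \<le> h a"
      using restart_doubles[of a] epoch[of a] a False by simp
    finally have "(\<Sum>s = 1..a - 1. g s \<bullet> free_range g h s) \<le> h a" .
    moreover have "(\<Sum>s = 1..t. g s \<bullet> free_range g h s)
        = (\<Sum>s = 1..a - 1. g s \<bullet> free_range g h s) + (\<Sum>s = a..t. g s \<bullet> free_range g h s)"
      using a sum.ub_add_nat[of 1 "a - 1" "\<lambda>s. g s \<bullet> free_range g h s" "t - (a - 1)"] by simp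
    ultimately show ?thesis
      using last unfolding a_def[symmetric] by simp
  qed
qed

section \<open>Regret against a comparator\<close>

lemma hint_square_le_b_total:
  assumes "1 \<le> t" "t \<le> T"
  shows "(h t)^2 \<le> (h (\<tau> t))^2 * (b_total g h T / 2)"
proof -
  have "(h t)^2 \<le> (h (\<tau> t) * ratio_sum t)^2"
    using hint_le_restart hint_pos assms by (intro power_mono) (auto simp: less_imp_le)
  also have "\<dots> \<le> (h (\<tau> t))^2 * (\<Sum>t = 1..T. (ratio_sum t)^2)"
    using assms unfolding power_mult_distrib by (intro mult_left_mono member_le_sum) auto
  finally show ?thesis by (simp add: b_total_eq)
qed

text \<open>Later rounds are bounded termwise by \<open>hint_le_restart\<close>. Round
  \<open>a\<close> pays for \<open>(h a)^2\<close> and for its own gradient, since together they are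
  at most \<open>2 * (h a)^2\<close> and \<open>ratio_sum a \<ge> 2\<close>.\<close>

lemma epoch_variance_le_b_total:
  assumes "1 \<le> a" "a \<le> n" "n \<le> T" "\<And>t. t \<in> {a..n} \<Longrightarrow> \<tau> t = a"
  shows "(h a)^2 + (\<Sum>t = a..n. (norm (g t))^2) \<le> (h a)^2 * (b_total g h T / 2)"
proof -
  have ha: "h a > 0" using assms hint_pos by auto
  have g_le: "(norm (g t))^2 \<le> (h a)^2 * (ratio_sum t)^2" if "t \<in> {Suc a..n}" for t
  proof -
    have "norm (g t) \<le> h a * ratio_sum t"
      using norm_le_hint[of t] hint_le_restart[of t] assms that by fastforce
    then show ?thesis
      unfolding power_mult_distrib[symmetric] by (rule power_mono) simp
  qed
  have "(norm (g a))^2 \<le> (h a)^2"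
    using norm_le_hint[of a] assms by (intro power_mono) auto
  moreover have "(h a)^2 * 2^2 \<le> (h a)^2 * (ratio_sum a)^2"
    using ratio_sum_ge_2 by (intro mult_left_mono power_mono) auto
  moreover have "p + q \<le> r" if "q \<le> p" "p * 2^2 \<le> r" "p \<ge> 0" for p q r :: real
    using that by simp
  ultimately have "(h a)^2 + (norm (g a))^2 \<le> (h a)^2 * (ratio_sum a)^2"
    using zero_le_power2[of "h a"] by blast
  moreover have "(\<Sum>t = Suc a..n. (norm (g t))^2) \<le> (\<Sum>t = Suc a..n. (h a)^2 * (ratio_sum t)^2)"
    by (intro sum_mono g_le)
  ultimately have "(h a)^2 + (\<Sum>t = a..n. (norm (g t))^2) \<le> (\<Sum>t = a..n. (h a)^2 * (ratio_sum t)^2)"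
    using assms(2) by (simp add: sum.atLeast_Suc_atMost)
  also have "\<dots> = (h a)^2 * (\<Sum>t = a..n. (ratio_sum t)^2)"
    by (simp add: sum_distrib_left)
  also have "\<dots> \<le> (h a)^2 * (\<Sum>t = 1..T. (ratio_sum t)^2)"
    using assms by (intro mult_left_mono sum_mono2) auto
  finally show ?thesis by (simp add: b_total_eq)
qed

text \<open>Cauchy-Schwarz reduces the regret to \<open>h a\<close> plus the conjugate of the scaled
  potential at \<open>norm w\<close>. The two preceding lemmas replace the arguments of its
  logarithms by multiples of \<open>b_total\<close>.\<close>

lemma epoch_regret_le:
  assumes a: "1 \<le> a" "a \<le> n" "n \<le> T" and epoch: "\<And>t. t \<in> {a..n} \<Longrightarrow> \<tau> t = a"
  shows "(\<Sum>t = a..n. g t \<bullet> (free_range g h t - w)) \<le> h a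
    + 2 * norm w * sqrt (((h a)^2 + (\<Sum>t = a..n. (norm (g t))^2)) * ln_plus (norm w * b_total g h T))
    + 4 * h n * norm w * ln_plus (2 * norm w * b_total g h T)"
proof -
  define V where "V = (h a)^2 + (\<Sum>t = a..n. (norm (g t))^2)"
  define G where "G = (\<Sum>t = a..n. g t)"
  define b where "b = b_total g h T"
  have hp: "h a > 0" "h n > 0" using hint_pos a by auto
  have V: "V > 0"
    unfolding V_def using hp by (intro add_pos_nonneg sum_nonneg) auto
  have Vb: "V \<le> (h a)^2 * (b / 2)"
    unfolding V_def b_def using a epoch by (rule epoch_variance_le_b_total)
  have "(h n)^2 \<le> (h a)^2 * (b / 2)"
    unfolding b_def using hint_square_le_b_total[of n T] epoch[of n] a by simp
  \<comment> \<open>Both \<open>h n\<close> and \<open>sqrt V\<close> are at most the square root of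
    \<open>(h a)^2 * (b / 2)\<close>.\<close>
  then have "h n * sqrt V \<le> sqrt ((h a)^2 * (b / 2)) * sqrt ((h a)^2 * (b / 2))"
    using Vb V hp by (intro mult_mono real_le_rsqrt) auto
  also have "\<dots> = (h a)^2 * (b / 2)"
    using Vb V by simp
  finally have hV: "4 * h n * sqrt V / (h a)^2 \<le> 2 * b"
    using hp by (simp add: field_simps)
  have V': "2 * V / (h a)^2 \<le> b"
    using Vb hp by (simp add: field_simps)
  have "(\<Sum>t = a..<Suc n. g t \<bullet> free_range g h t)
      \<le> h a - (h a)^2 * potential ((h a)^2 + (\<Sum>t = a..<Suc n. (norm (g t))^2)) (h n) (norm (\<Sum>t = a..<Suc n. g t))"
    using a epoch hint_mono hp by (intro epoch_loss_le) auto
  then have loss: "(\<Sum>t = a..n. g t \<bullet> free_range g h t) \<le> h a - (h a)^2 * potential V (h n) (norm G)"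
    by (simp add: V_def G_def atLeastLessThanSuc_atLeastAtMost)
  have "(\<Sum>t = a..n. g t \<bullet> (free_range g h t - w))
      = (\<Sum>t = a..n. g t \<bullet> free_range g h t) - G \<bullet> w"
    by (simp add: G_def inner_diff_right sum_subtractf inner_sum_left)
  also have "- (G \<bullet> w) \<le> norm w * norm G"
    using Cauchy_Schwarz_ineq2[of G w] by (simp add: mult.commute abs_le_iff)
  then have "(\<Sum>t = a..n. g t \<bullet> free_range g h t) - G \<bullet> w
      \<le> h a + (norm w * norm G - (h a)^2 * potential V (h n) (norm G))"
    using loss by linarith
  also have "norm w * norm G - (h a)^2 * potential V (h n) (norm G)
      \<le> 2 * norm w * sqrt (V * ln_plus (2 * norm w * V / (h a)^2))
        + 4 * h n * norm w * ln_plus (4 * h n * norm w * sqrt V / (h a)^2)"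
    using V hp by (intro potential_conjugate_le) auto
  also have "ln_plus (2 * norm w * V / (h a)^2) \<le> ln_plus (norm w * b)"
    using mult_left_mono[OF V', of "norm w"] V by (intro ln_plus_mono) (auto simp: mult_ac)
  also have "ln_plus (4 * h n * norm w * sqrt V / (h a)^2) \<le> ln_plus (2 * norm w * b)"
    using mult_left_mono[OF hV, of "norm w"] V hp by (intro ln_plus_mono) (auto simp: mult_ac)
  finally show ?thesis
    using V hp by (simp add: V_def b_def mult_left_mono)
qed

text \<open>No potential is compared with \<open>w\<close> here. As \<open>h t \<le> h a'\<close>,
  the norms before \<open>a'\<close> sum to at most \<open>h a' * ratio_sum a\<close>, which the
  restart in round \<open>a\<close> bounds by \<open>h a\<close>. The losses are at most
  \<open>h a'\<close> by doubling at \<open>a'\<close>.\<close>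

lemma early_regret_le:
  assumes a: "\<tau> a = a" "a > 1" and a': "a' = \<tau> (a - 1)"
  shows "(\<Sum>t = 1..<a'. g t \<bullet> (free_range g h t - w)) \<le> h a' + norm w * h a"
proof -
  have a'1: "1 \<le> a'" "a' \<le> a - 1"
    using restart_round_ge_1 restart_round_le[of "a - 1"] a(2) by (auto simp: a')
  have fix_a': "\<tau> a' = a'"
    using restart_round_epoch[of "a - 1" a'] a'1 a(2) by (simp add: a')
  have hp: "h a' > 0" using hint_pos a'1 by simp
  have loss: "(\<Sum>t = 1..<a'. g t \<bullet> free_range g h t) \<le> h a'"
  proof (cases "a' = 1")
    case True
    with hp show ?thesis by simp
  next
    case False
    then have "(\<Sum>t = 1..a' - 1. g t \<bullet> free_range g h t) \<le> 2 * h (\<tau> (a' - 1))"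
      using a'1 by (intro total_loss_le) auto
    also have "\<dots> \<le> h a'"
      using False a'1 fix_a' by (intro restart_doubles) auto
    also have "{1..a' - 1} = {1..<a'}"
      using a'1 by auto
    finally show ?thesis .
  qed
  have "(\<Sum>t = 1..<a'. norm (g t)) \<le> (\<Sum>t = 1..<a'. h a' * (norm (g t) / h t))"
  proof (rule sum_mono)
    fix t assume t: "t \<in> {1..<a'}"
    then have "h t > 0" "h t \<le> h a'"
      using hint_pos hint_mono[of t a'] by auto
    then have "norm (g t) * h t \<le> norm (g t) * h a'"
      by (intro mult_left_mono) auto
    then show "norm (g t) \<le> h a' * (norm (g t) / h t)"
      using \<open>h t > 0\<close> by (simp add: field_simps)
  qed
  also have "\<dots> = h a' * (\<Sum>t = 1..<a'. norm (g t) / h t)"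
    by (simp add: sum_distrib_left)
  also have "\<dots> \<le> h a' * ratio_sum a"
  proof -
    have "(\<Sum>t = 1..<a'. norm (g t) / h t) \<le> (\<Sum>t = 1..<a. norm (g t) / h t)"
      using a'1 hint_pos by (intro sum_mono2) (auto simp: less_imp_le)
    then show ?thesis
      using hp by (intro mult_left_mono) (auto simp: ratio_sum_def)
  qed
  also have "\<dots> \<le> h a"
    using restart_jump[OF a] by (simp add: a')
  finally have norms: "(\<Sum>t = 1..<a'. norm (g t)) \<le> h a" .
  have "- (\<Sum>t = 1..<a'. g t \<bullet> w) = (\<Sum>t = 1..<a'. - (g t \<bullet> w))"
    by (simp add: sum_negf)
  also have "\<dots> \<le> (\<Sum>t = 1..<a'. norm w * norm (g t))"
  proof (rule sum_mono)
    show "- (g t \<bullet> w) \<le> norm w * norm (g t)" for t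
      using Cauchy_Schwarz_ineq2[of "g t" w] by (simp add: mult.commute abs_le_iff)
  qed
  also have "\<dots> \<le> norm w * h a"
    using norms by (simp add: sum_distrib_left[symmetric] mult_left_mono)
  finally show ?thesis
    using loss by (simp add: inner_diff_right sum_subtractf)
qed

text \<open>The rounds split at the last restart \<open>a\<close> and the one before it,
  \<open>a'\<close>. The coefficient of \<open>h T * x * M\<close> comes to 4 + 4 + 5/2 and that of
  \<open>h T * x\<close> to 2; the remaining hints satisfy
  \<open>2 * h a' + h a \<le> 2 * h T\<close>.\<close>

lemma regret_le:
  assumes T: "T \<ge> 1"
  shows "(\<Sum>t = 1..T. g t \<bullet> (free_range g h t - w))
    \<le> 2 * norm w * sqrt (2 * V_total g h T * ln_plus (norm w * b_total g h T))
      + h T * (16 * norm w * ln_plus (2 * norm w * b_total g h T) + 2 * norm w + 3)"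
proof -
  define a where "a = \<tau> T"
  define b where "b = b_total g h T"
  define x where "x = norm w"
  define L where "L = ln_plus (x * b)"
  define M where "M = ln_plus (2 * x * b)"
  define V where "V = (\<lambda>a n. (h a)^2 + (\<Sum>t = a..n. (norm (g t))^2))"
  define R where "R = (\<lambda>A. \<Sum>t\<in>A. g t \<bullet> (free_range g h t - w))"
  have a: "1 \<le> a" "a \<le> T"
    using restart_round_ge_1 restart_round_le T by (auto simp: a_def)
  have epoch: "\<tau> s = a" if "s \<in> {a..T}" for s
    using restart_round_epoch T that unfolding a_def by blast
  have x: "x \<ge> 0" by (simp add: x_def)
  have b: "b \<ge> 0" by (simp add: b_def b_total_eq sum_nonneg)
  have L: "L \<ge> 0" "L \<le> M"
    using x b by (auto simp: L_def M_def ln_plus_nonneg intro!: ln_plus_mono)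
  have hp: "h a > 0" "h T > 0" "h a \<le> h T" using hint_pos hint_mono a T by auto
  have V0: "V m n \<ge> 0" for m n
    unfolding V_def by (intro add_nonneg_nonneg sum_nonneg) auto
  have last: "R {a..T} \<le> h a + 2 * x * sqrt (V a T * L) + 4 * h T * x * M"
    using epoch_regret_le[OF a order.refl epoch, of w]
    by (simp add: R_def V_def L_def M_def x_def b_def)
  have "R {1..T} \<le> 2 * x * sqrt (2 * V 1 T * L) + h T * (16 * x * M + 2 * x + 3)"
  proof (cases "a = 1")
    case True
    \<comment> \<open>There is a single epoch, whose bound suffices.\<close>
    have "sqrt (V 1 T * L) \<le> sqrt (2 * V 1 T * L)"
      using V0 L by (simp add: mult_right_mono)
    then have "2 * x * sqrt (V 1 T * L) \<le> 2 * x * sqrt (2 * V 1 T * L)"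
      using x by (intro mult_left_mono) auto
    moreover have "h T * (16 * x * M + 2 * x + 3)
        = 4 * h T * x * M + 12 * (h T * x * M) + 2 * (h T * x) + 3 * h T"
      by (simp add: algebra_simps)
    moreover have "h T * x * M \<ge> 0" "h T * x \<ge> 0"
      using hp x L by auto
    ultimately show ?thesis
      using last hp unfolding True by linarith
  next
    case False
    define n where "n = a - 1"
    define a' where "a' = \<tau> n"
    have n: "n \<ge> 1" "n \<le> T" "a = Suc n" using False a by (auto simp: n_def)
    have a': "1 \<le> a'" "a' \<le> n"
      using restart_round_ge_1 restart_round_le n by (auto simp: a'_def)
    have epoch': "\<tau> s = a'" if "s \<in> {a'..n}" for s
      using restart_round_epoch n that unfolding a'_def by blast
    have fix_a: "\<tau> a = a" "a > 1" using epoch a False by auto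
    have hp': "h a' > 0" "h n \<le> h T"
      using hint_pos[OF a'(1)] hint_mono[OF n(1,2)] by auto
    have ha': "2 * h a' \<le> h a"
      using restart_doubles[OF fix_a] by (simp only: a'_def n_def)
    have early: "R {1..<a'} \<le> h a' + x * h a"
      unfolding R_def x_def using fix_a by (rule early_regret_le) (simp add: a'_def n_def)
    have "R {a'..n} \<le> h a' + 2 * x * sqrt (V a' n * L) + 4 * h n * x * M"
      using epoch_regret_le[OF a' n(2) epoch', of w]
      by (simp add: R_def V_def L_def M_def x_def b_def)
    also have "4 * h n * x * M \<le> 4 * h T * x * M"
      using hp' x L by (intro mult_right_mono) auto
    finally have mid: "R {a'..n} \<le> h a' + 2 * x * sqrt (V a' n * L) + 4 * h T * x * M"
      by simp
    have split: "sum f {1..T} = sum f {1..<a'} + sum f {a'..n} + sum f {a..T}" for f :: "nat \<Rightarrow> real"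
    proof -
      have "{1..T} = {1..<a'} \<union> {a'..n} \<union> {a..T}"
        using a a' n by auto
      then show ?thesis
        using a' n by (simp add: sum.union_disjoint Int_Un_distrib2 disjoint_iff)
    qed
    \<comment> \<open>The excess is \<open>(h a)^2 + (h a')^2\<close>, and
      \<open>2 * h a' \<le> h a \<le> h T\<close> gives 5/4 = 1 + 1/4.\<close>
    have "V a' n + V a T \<le> V 1 T + 5/4 * (h T)^2"
    proof -
      have "(2 * h a')^2 \<le> (h T)^2" "(h a)^2 \<le> (h T)^2"
        by (rule power_mono; use hp hp' ha' in linarith)+
      moreover have "(\<Sum>t = 1..<a'. (norm (g t))^2) \<ge> 0"
        by (intro sum_nonneg) simp
      moreover have "p + u + (q + v) \<le> r + (s + u + v) + 5/4 * m"
        if "2^2 * p \<le> m" "q \<le> m" "s \<ge> 0" "r \<ge> 0" for p q r s u v m :: real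
        using that by simp
      ultimately show ?thesis
        using zero_le_power2[of "h 1"]
        unfolding V_def split[of "\<lambda>t. (norm (g t))^2"] power_mult_distrib by blast
    qed
    then have "2 * (V a' n * L + V a T * L) \<le> 2 * V 1 T * L + (h T)^2 * (5/2 * L)"
      using mult_right_mono[of "V a' n + V a T" "V 1 T + 5/4 * (h T)^2" L] L
      by (simp add: algebra_simps)
    then have "sqrt (2 * (V a' n * L + V a T * L)) \<le> sqrt (2 * V 1 T * L + (h T)^2 * (5/2 * L))"
      by simp
    also have "\<dots> \<le> sqrt (2 * V 1 T * L) + sqrt ((h T)^2 * (5/2 * L))"
      using V0 L by (intro sqrt_add_le_add_sqrt) auto
    also have "sqrt ((h T)^2 * (5/2 * L)) = h T * sqrt (5/2 * L)"
      using hp unfolding real_sqrt_mult by simp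
    finally have "sqrt (V a' n * L) + sqrt (V a T * L)
        \<le> sqrt (2 * V 1 T * L) + h T * sqrt (5/2 * L)"
      using V0 L by (intro order.trans[OF sqrt_add_sqrt_le]) auto
    \<comment> \<open>The arithmetic-geometric mean inequality turns the root into a linear term,
      absorbed by the summands with \<open>x\<close> and \<open>x * M\<close>.\<close>
    also have "sqrt (5/2 * L) \<le> (1 + 5/2 * L) / 2"
      using arith_geo_mean_sqrt[of 1 "5/2 * L"] L by simp
    finally have "sqrt (V a' n * L) + sqrt (V a T * L)
        \<le> sqrt (2 * V 1 T * L) + h T * ((1 + 5/2 * L) / 2)"
      using hp by (simp add: mult_left_mono)
    then have "2 * x * (sqrt (V a' n * L) + sqrt (V a T * L))
        \<le> 2 * x * (sqrt (2 * V 1 T * L) + h T * ((1 + 5/2 * L) / 2))"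
      using x by (intro mult_left_mono) auto
    then have sqrts: "2 * x * sqrt (V a' n * L) + 2 * x * sqrt (V a T * L)
        \<le> 2 * x * sqrt (2 * V 1 T * L) + h T * x + 5/2 * (h T * x * L)"
      by (simp add: algebra_simps add_divide_distrib)
    have "R {1..T} = R {1..<a'} + R {a'..n} + R {a..T}"
      unfolding R_def by (rule split)
    moreover have "x * h a \<le> h T * x"
      using hp x by (simp add: mult.commute mult_left_mono)
    moreover have "h T * x * L \<le> h T * x * M" "h T * x * M \<ge> 0"
      using hp x L by (auto intro!: mult_left_mono)
    moreover have "h T * (16 * x * M + 2 * x + 3) = 16 * (h T * x * M) + 2 * (h T * x) + 3 * h T"
        "4 * h T * x * M = 4 * (h T * x * M)"
      by (simp_all add: algebra_simps)
    ultimately show ?thesis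
      using early mid last sqrts hp hp' ha' by linarith
  qed
  then show ?thesis
    by (simp add: R_def V_def V_total_def L_def M_def x_def b_def)
qed

end

theorem theorem7:
  fixes g :: "nat \<Rightarrow> real ^ 'd"
    and hint :: "(nat \<Rightarrow> real ^ 'd) \<Rightarrow> nat \<Rightarrow> real"
    and h :: "nat \<Rightarrow> real"
  assumes "norm (g 1) > 0"
    and "h = hint g"
    and "mono_on {1..} h"
    and "\<And>t. t \<ge> 1 \<Longrightarrow> h t \<ge> Max ((\<lambda>s. norm (g s)) ` {1..t})"
    and "\<And>c t. c > 0 \<Longrightarrow> t \<ge> 1 \<Longrightarrow> hint (\<lambda>s. c *\<^sub>R g s) t = c * hint g t"
  shows "\<forall>(w :: real ^ 'd) (T :: nat). T \<ge> 1 \<longrightarrow>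
      (\<Sum>t = 1..T. g t \<bullet> (free_range g h t - w))
        \<le> 2 * norm w * sqrt (2 * V_total g h T * ln_plus (norm w * b_total g h T))
          + h T * (16 * norm w * ln_plus (2 * norm w * b_total g h T) + 2 * norm w + 3)
      \<and> b_total g h T \<le> (real T + 1) ^ 3"
proof -
  have bound: "norm (g t) \<le> h t" if "t \<ge> 1" for t
  proof -
    have "norm (g t) \<le> Max ((\<lambda>s. norm (g s)) ` {1..t})"
      using that by (intro Max_ge) auto
    then show ?thesis using assms(4)[OF that] by simp
  qed
  interpret hinted_sequence g h
  proof
    show "h 1 > 0" using bound[of 1] assms(1) by linarith
    show "h s \<le> h t" if "1 \<le> s" "s \<le> t" for s t
      using assms(3) that by (auto simp: mono_on_def)
  qed (rule bound)
  show ?thesis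
    by (intro allI impI conjI regret_le b_total_le_cube)
qed

end
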